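(* Let $\Pi$ be a decidable equivalence relation on $\mathbb{N}$. Then $\operatorname{Perm}\Pi = \max \mathcal{I}\Pi$, i.e. the recursive permutations whose cycles are exactly the blocks of $\Pi$ are precisely the maximal elements of $\mathcal{I}\Pi$ with respect to the preorder $\lesssim$.
   Context: $\mathcal{G}$ is the group of recursive permutations of $\mathbb{N}$; $[x]_f = \{f^k(x):k\in\mathbb{Z}\}$; $P(x,\Pi)$ is the block of $\Pi$ containing $x$. $\operatorname{Perm}\Pi = \{f \in \mathcal{G} : [x]_f = P(x,\Pi) \text{ for all } x\}$. $\operatorname{Aut}\Pi$ is the set of recursive permutations $\theta$ with $x\Pi y \iff \theta(x)\Pi\theta(y)$. $\mathcal{I}\Pi = \{f \in \operatorname{Aut}\Pi : f(P) = P \text{ for every block } P \in \Pi\}$. On $\mathcal{I}\Pi$, $f \lesssim g$ means $[x]_f \subseteq [x]_g$ for all $x$; $f \lnsim g$ means $f \lesssim g$ and not $g \lesssim f$. $\max\mathcal{I}\Pi$ is the set of $f \in \mathcal{I}\Pi$ for which there is no $g \in \mathcal{I}\Pi$ with $f \lnsim g$. *)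

theory Defs
  imports Main
begin

text \<open>
  \<open>recursive n f\<close>: the \<open>n\<close>-ary function \<open>f\<close> is (total, general) recursive, i.e. belongs to the least
  class containing the zero, successor and projection functions and closed under composition,
  primitive recursion and regular minimisation.  Argument tuples are lists of length \<open>n\<close>; the values
  of \<open>f\<close> on lists of any other length are irrelevant, which is what rule \<open>ext\<close> expresses.
\<close>

inductive recursive :: "nat \<Rightarrow> (nat list \<Rightarrow> nat) \<Rightarrow> bool" where
  zero: "recursive n (\<lambda>xs. 0)"
| succ: "recursive 1 (\<lambda>xs. Suc (xs ! 0))"
| proj: "i < n \<Longrightarrow> recursive n (\<lambda>xs. xs ! i)"
| comp: "recursive (length gs) f \<Longrightarrow> (\<And>g. g \<in> set gs \<Longrightarrow> recursive n g)
    \<Longrightarrow> recursive n (\<lambda>xs. f (map (\<lambda>g. g xs) gs))"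
| prec: "recursive n f \<Longrightarrow> recursive (Suc (Suc n)) g
    \<Longrightarrow> recursive (Suc n) (\<lambda>xs. rec_nat (f (tl xs)) (\<lambda>k r. g (k # r # tl xs)) (hd xs))"
| mu: "recursive (Suc n) f \<Longrightarrow> (\<And>xs. length xs = n \<Longrightarrow> \<exists>y. f (y # xs) = 0)
    \<Longrightarrow> recursive n (\<lambda>xs. LEAST y. f (y # xs) = 0)"
| ext: "recursive n f \<Longrightarrow> (\<And>xs. length xs = n \<Longrightarrow> g xs = f xs) \<Longrightarrow> recursive n g"

definition decidable_rel :: "nat rel \<Rightarrow> bool" where
  "decidable_rel \<Pi> \<longleftrightarrow> recursive 2 (\<lambda>xs. if (xs ! 0, xs ! 1) \<in> \<Pi> then 1 else 0)"

definition rec_perms :: "(nat \<Rightarrow> nat) set" where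
  "rec_perms = {f. bij f \<and> recursive 1 (\<lambda>xs. f (xs ! 0))}"

text \<open>Integer iterates; only meaningful for bijective \<open>f\<close>.\<close>

definition int_iter :: "('a \<Rightarrow> 'a) \<Rightarrow> int \<Rightarrow> 'a \<Rightarrow> 'a" where
  "int_iter f k = (if k \<ge> 0 then f ^^ nat k else inv f ^^ nat (- k))"

definition cycle_of :: "('a \<Rightarrow> 'a) \<Rightarrow> 'a \<Rightarrow> 'a set" where
  "cycle_of f x = {int_iter f k x | k :: int. True}"

definition block :: "'a \<Rightarrow> 'a rel \<Rightarrow> 'a set" where
  "block x \<Pi> = \<Pi> `` {x}"

definition Perm :: "nat rel \<Rightarrow> (nat \<Rightarrow> nat) set" where
  "Perm \<Pi> = {f \<in> rec_perms. \<forall>x. cycle_of f x = block x \<Pi>}"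

definition Aut :: "nat rel \<Rightarrow> (nat \<Rightarrow> nat) set" where
  "Aut \<Pi> = {\<theta> \<in> rec_perms. \<forall>x y. (x, y) \<in> \<Pi> \<longleftrightarrow> (\<theta> x, \<theta> y) \<in> \<Pi>}"

definition Inner :: "nat rel \<Rightarrow> (nat \<Rightarrow> nat) set" where
  "Inner \<Pi> = {f \<in> Aut \<Pi>. \<forall>P \<in> UNIV // \<Pi>. f ` P = P}"

definition cycle_le :: "('a \<Rightarrow> 'a) \<Rightarrow> ('a \<Rightarrow> 'a) \<Rightarrow> bool" (infix "\<lesssim>" 50) where
  "f \<lesssim> g \<longleftrightarrow> (\<forall>x. cycle_of f x \<subseteq> cycle_of g x)"

definition cycle_less :: "('a \<Rightarrow> 'a) \<Rightarrow> ('a \<Rightarrow> 'a) \<Rightarrow> bool" (infix "\<lnsim>" 50) where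
  "f \<lnsim> g \<longleftrightarrow> f \<lesssim> g \<and> \<not> g \<lesssim> f"

definition maximal :: "('a \<Rightarrow> 'a) set \<Rightarrow> ('a \<Rightarrow> 'a) set" where
  "maximal F = {f \<in> F. \<not> (\<exists>g \<in> F. f \<lnsim> g)}"

end

theory Submission
  imports Defs "HOL-Library.Infinite_Set"
begin

text \<open>
  Every member of \<^term>\<open>Inner \<Pi>\<close> has its cycles inside the blocks, so a permutation whose cycles are
  the blocks is maximal.  Conversely, if some block \<open>P\<close> of \<open>\<Pi>\<close> is not a cycle of \<open>f\<close>, redefine \<open>f\<close> on
  this single block so that \<open>P\<close> becomes one cycle.  If \<open>P\<close> is finite this is a finite change; if \<open>P\<close>
  is infinite, decidability of \<open>P\<close> makes its increasing enumeration and the inverse of that recursive, and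
  one transports the two-sided cycle \<open>\<dots>, 5, 3, 1, 0, 2, 4, \<dots>\<close> from \<open>\<nat>\<close> to \<open>P\<close>.
\<close>

section \<open>Closure properties of recursive functions\<close>

lemma recursive_comp1:
  assumes "recursive 1 (\<lambda>xs. f (xs ! 0))" "recursive n a"
  shows "recursive n (\<lambda>xs. f (a xs))"
  using recursive.comp[of "[a]" "\<lambda>xs. f (xs ! 0)" n] assms by simp

lemma recursive_comp2:
  assumes "recursive 2 (\<lambda>xs. f (xs ! 0) (xs ! 1))" "recursive n a" "recursive n b"
  shows "recursive n (\<lambda>xs. f (a xs) (b xs))"
  using recursive.comp[of "[a, b]" "\<lambda>xs. f (xs ! 0) (xs ! 1)" n] assms
  by (auto simp: numeral_2_eq_2)

lemma recursive_Suc: "recursive n a \<Longrightarrow> recursive n (\<lambda>xs. Suc (a xs))"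
  by (rule recursive_comp1[OF recursive.succ])

lemma recursive_const: "recursive n (\<lambda>_. c)"
  by (induction c) (auto intro: recursive.zero recursive_Suc)

text \<open>Rule \<open>prec\<close> recurses on the head of the argument list. Composing with
  \<open>h\<close> and all projections frees the recursion argument and keeps the whole list as
  parameters.\<close>

lemma recursive_rec_nat:
  assumes "recursive n f" "recursive (Suc (Suc n)) g" "recursive n h"
  shows "recursive n (\<lambda>xs. rec_nat (f xs) (\<lambda>k r. g (k # r # xs)) (h xs))"
proof -
  let ?gs = "h # map (\<lambda>i xs. xs ! i) [0..<n]"
  have "recursive n (\<lambda>xs. (\<lambda>xs. rec_nat (f (tl xs)) (\<lambda>k r. g (k # r # tl xs)) (hd xs))
      (map (\<lambda>g. g xs) ?gs))"
    using recursive.prec[OF assms(1,2)] assms(3)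
    by (intro recursive.comp) (auto intro: recursive.proj)
  then show ?thesis
  proof (rule recursive.ext)
    fix xs :: "nat list"
    assume "length xs = n"
    then have "map ((\<lambda>g. g xs) \<circ> (\<lambda>i xs. xs ! i)) [0..<n] = xs"
      by (intro nth_equalityI) auto
    then show "rec_nat (f xs) (\<lambda>k r. g (k # r # xs)) (h xs) =
        (\<lambda>xs. rec_nat (f (tl xs)) (\<lambda>k r. g (k # r # tl xs)) (hd xs)) (map (\<lambda>g. g xs) ?gs)"
      by simp
  qed
qed

lemma recursive_pred: "recursive 1 (\<lambda>xs. xs ! 0 - 1)"
proof -
  have "recursive 1 (\<lambda>xs. rec_nat 0 (\<lambda>k r. (k # r # xs) ! 0) (xs ! 0))"
    by (intro recursive_rec_nat recursive.zero recursive.proj) auto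
  moreover have "rec_nat 0 (\<lambda>k r. (k # r # xs) ! 0) m = m - 1" for m and xs :: "nat list"
    by (cases m) auto
  ultimately show ?thesis by simp
qed

lemma recursive_diff:
  assumes "recursive n a" "recursive n b"
  shows "recursive n (\<lambda>xs. a xs - b xs)"
proof (rule recursive_comp2[where f = "(-)", OF _ assms])
  have "recursive 2 (\<lambda>xs. rec_nat (xs ! 0) (\<lambda>k r. (k # r # xs) ! 1 - 1) (xs ! 1))"
    by (intro recursive_rec_nat recursive_comp1[OF recursive_pred] recursive.proj) auto
  moreover have "rec_nat m (\<lambda>k r. (k # r # xs) ! 1 - 1) j = m - j" for m j and xs :: "nat list"
    by (induction j) auto
  ultimately show "recursive 2 (\<lambda>xs. xs ! 0 - xs ! 1)" by simp
qed

lemma recursive_add: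
  assumes "recursive n a" "recursive n b"
  shows "recursive n (\<lambda>xs. a xs + b xs)"
proof (rule recursive_comp2[where f = "(+)", OF _ assms])
  have "recursive 2 (\<lambda>xs. rec_nat (xs ! 0) (\<lambda>k r. Suc ((k # r # xs) ! 1)) (xs ! 1))"
    by (intro recursive_rec_nat recursive_Suc recursive.proj) auto
  moreover have "rec_nat m (\<lambda>k r. Suc ((k # r # xs) ! 1)) j = m + j" for m j and xs :: "nat list"
    by (induction j) auto
  ultimately show "recursive 2 (\<lambda>xs. xs ! 0 + xs ! 1)" by simp
qed

text \<open>Primitive recursion on \<open>a xs\<close> whose step ignores counter and previous
  value: zero steps give \<open>b xs\<close>, any positive number gives \<open>c xs\<close>.\<close>

lemma recursive_if_zero:
  assumes "recursive n a" "recursive n b" "recursive n c"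
  shows "recursive n (\<lambda>xs. if a xs = 0 then b xs else c xs)"
proof -
  \<comment> \<open>The shift by 2 skips the counter and the accumulator in front of the
    parameters.\<close>
  let ?gs = "map (\<lambda>i xs. xs ! (i + 2)) [0..<n]"
  have "recursive (Suc (Suc n)) (\<lambda>xs. c (map (\<lambda>g. g xs) ?gs))"
    using assms(3) by (intro recursive.comp) (auto intro: recursive.proj)
  then have "recursive (Suc (Suc n)) (\<lambda>xs. c (drop 2 xs))"
  proof (rule recursive.ext)
    fix xs :: "nat list"
    assume "length xs = Suc (Suc n)"
    then have "map (\<lambda>g. g xs) ?gs = drop 2 xs"
      by (intro nth_equalityI) (auto simp: add.commute)
    then show "c (drop 2 xs) = c (map (\<lambda>g. g xs) ?gs)" by simp
  qed
  from recursive_rec_nat[OF assms(2) this assms(1)]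
  show ?thesis
    by (rule recursive.ext) (auto simp: gr0_conv_Suc)
qed

lemma recursive_if_eq:
  assumes "recursive n a" "recursive n a'" "recursive n b" "recursive n c"
  shows "recursive n (\<lambda>xs. if a xs = a' xs then b xs else c xs)"
proof -
  have "recursive n (\<lambda>xs. if (a xs - a' xs) + (a' xs - a xs) = 0 then b xs else c xs)"
    by (intro recursive_if_zero recursive_add recursive_diff assms)
  moreover have "(k - j) + (j - k) = 0 \<longleftrightarrow> k = j" for j k :: nat by auto
  ultimately show ?thesis by simp
qed

text \<open>Induction on the exceptional set: resetting \<open>g\<close> at one point to the value
  of \<open>f\<close> shrinks the set, and an equality test against that point restores
  \<open>g\<close>.\<close>

lemma recursive_finite_change:
  assumes "finite A" "recursive 1 (\<lambda>xs. f (xs ! 0))" "\<And>x. x \<notin> A \<Longrightarrow> g x = f x"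
  shows "recursive 1 (\<lambda>xs. g (xs ! 0))"
  using assms(1,3)
proof (induction A arbitrary: g rule: finite_induct)
  case empty
  then show ?case using assms(2) by simp
next
  case (insert a A)
  have "recursive 1 (\<lambda>xs. (g(a := f a)) (xs ! 0))"
    using insert.prems by (intro insert.IH) auto
  then have "recursive 1 (\<lambda>xs. if xs ! 0 = a then g a else (g(a := f a)) (xs ! 0))"
    by (intro recursive_if_eq recursive.proj recursive_const) auto
  then show ?case
    by (rule recursive.ext) auto
qed

section \<open>Enumerating an infinite decidable set\<close>

text \<open>Truth is coded by 0 because minimisation looks for a zero; the second assumption is the
  regularity demanded by \<open>mu\<close>.\<close>

lemma recursive_Least:
  assumes "recursive (Suc n) (\<lambda>xs. if R xs then 0 else 1)"
    and "\<And>xs. length xs = n \<Longrightarrow> \<exists>y. R (y # xs)"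
  shows "recursive n (\<lambda>xs. LEAST y. R (y # xs))"
proof -
  have "recursive n (\<lambda>xs. LEAST y. (if R (y # xs) then 0 else 1 :: nat) = 0)"
    using assms by (intro recursive.mu) auto
  moreover have "(if Q then 0 else 1 :: nat) = 0 \<longleftrightarrow> Q" for Q by simp
  ultimately show ?thesis by simp
qed

lemma recursive_enumerate:
  assumes "infinite P" and dec: "recursive 1 (\<lambda>xs. if xs ! 0 \<in> P then 1 else 0)"
  shows "recursive 1 (\<lambda>xs. enumerate P (xs ! 0))"
proof -
  define \<chi> where "\<chi> x = (if x \<in> P then 1 else (0::nat))" for x
  define next_in where "next_in r = (LEAST s. s \<in> P \<and> r < s)" for r
  have \<chi>: "recursive 1 (\<lambda>xs. \<chi> (xs ! 0))"
    using dec by (simp add: \<chi>_def)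
  \<comment> \<open>With \<open>s\<close> at position 0 and \<open>r\<close> at position 1,
    \<open>r < s\<close> is expressed by the truncated difference \<open>Suc r - s\<close> being
    0.\<close>
  have "recursive (Suc 1) (\<lambda>xs. if \<chi> (xs ! 0) = 0 then 1
      else if Suc (xs ! 1) - xs ! 0 = 0 then 0 else 1)"
    by (intro recursive_if_zero recursive_comp1[OF \<chi>] recursive_diff recursive_Suc
        recursive_const recursive.proj) auto
  then have "recursive (Suc 1) (\<lambda>xs. if xs ! 0 \<in> P \<and> xs ! 1 < xs ! 0 then 0 else 1)"
    by (rule recursive.ext) (auto simp: \<chi>_def)
  \<comment> \<open>Infinitude of \<open>P\<close> makes this search always succeed.\<close>
  then have "recursive 1 (\<lambda>xs. LEAST s. (s # xs) ! 0 \<in> P \<and> (s # xs) ! 1 < (s # xs) ! 0)"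
    using assms(1) by (intro recursive_Least) (auto simp: infinite_nat_iff_unbounded)
  then have next_in: "recursive 1 (\<lambda>xs. next_in (xs ! 0))"
    by (simp add: next_in_def)
  have "recursive 1 (\<lambda>xs. rec_nat (enumerate P 0) (\<lambda>k r. next_in ((k # r # xs) ! 1)) (xs ! 0))"
    by (intro recursive_rec_nat recursive_comp1[OF next_in] recursive_const recursive.proj) auto
  moreover have "rec_nat (enumerate P 0) (\<lambda>k r. next_in ((k # r # xs) ! 1)) m = enumerate P m"
    for m and xs :: "nat list"
    by (induction m) (simp_all add: next_in_def enumerate_Suc'' assms(1))
  ultimately show ?thesis by simp
qed

lemma recursive_enumerate_inverse:
  assumes "infinite P" and dec: "recursive 1 (\<lambda>xs. if xs ! 0 \<in> P then 1 else 0)"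
  obtains r where "recursive 1 (\<lambda>xs. r (xs ! 0))" "\<And>n. r (enumerate P n) = n"
proof
  \<comment> \<open>The implication holds vacuously outside \<open>P\<close>, so the search for an
    index is total.\<close>
  let ?R = "\<lambda>xs. xs ! 1 \<in> P \<longrightarrow> enumerate P (xs ! 0) = xs ! 1"
  define \<chi> where "\<chi> x = (if x \<in> P then 1 else (0::nat))" for x
  have \<chi>: "recursive 1 (\<lambda>xs. \<chi> (xs ! 0))"
    using dec by (simp add: \<chi>_def)
  have "recursive (Suc 1) (\<lambda>xs. if \<chi> (xs ! 1) = 0 then 0
      else if enumerate P (xs ! 0) = xs ! 1 then 0 else 1)"
    by (intro recursive_if_zero recursive_if_eq recursive_comp1[OF \<chi>]
        recursive_comp1[OF recursive_enumerate[OF assms]] recursive_const recursive.proj) auto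
  then have "recursive (Suc 1) (\<lambda>xs. if ?R xs then 0 else 1)"
    by (rule recursive.ext) (auto simp: \<chi>_def)
  then have "recursive 1 (\<lambda>xs. LEAST n. ?R (n # xs))"
    by (intro recursive_Least) (auto intro: enumerate_Ex[OF assms(1)])
  then show "recursive 1 (\<lambda>xs. (\<lambda>x. LEAST n. x \<in> P \<longrightarrow> enumerate P n = x) (xs ! 0))"
    by simp
  show "(\<lambda>x. LEAST n. x \<in> P \<longrightarrow> enumerate P n = x) (enumerate P n) = n" for n
    using assms(1) by (auto simp: enumerate_in_set inj_eq[OF strict_mono_imp_inj_on[OF strict_mono_enumerate]]
        intro!: Least_equality)
qed

section \<open>Cycles\<close>

text \<open>Since \<open>P\<close> equals its image under the injective \<open>f\<close>, it is also
  closed under \<open>inv f\<close>, which covers negative exponents.\<close>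

lemma int_iter_mem_closed:
  assumes "bij f" "f ` P = P" "x \<in> P"
  shows "int_iter f k x \<in> P"
proof -
  have "inv f y \<in> P" if "y \<in> P" for y
    using that assms(1,2) by (metis bij_is_inj image_inv_f_f imageI)
  then have "(inv f ^^ n) x \<in> P" for n
    by (induction n) (auto simp: assms(3))
  moreover have "(f ^^ n) x \<in> P" for n
    using assms(2,3) by (induction n) auto
  ultimately show ?thesis by (simp add: int_iter_def)
qed

lemma cycle_of_subset_closed: "bij f \<Longrightarrow> f ` P = P \<Longrightarrow> x \<in> P \<Longrightarrow> cycle_of f x \<subseteq> P"
  by (auto simp: cycle_of_def int_iter_mem_closed)

lemma cycle_of_cong:
  assumes "bij f" "bij g" "f ` P = P" "\<And>y. y \<in> P \<Longrightarrow> f y = g y" "x \<in> P"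
  shows "cycle_of f x = cycle_of g x"
proof -
  have closed: "inv f y \<in> P" if "y \<in> P" for y
    using that assms(1,3) by (metis bij_is_inj image_inv_f_f imageI)
  have inv_eq: "inv f y = inv g y" if "y \<in> P" for y
    using closed[OF that] assms(1,2,4) by (metis bij_inv_eq_iff)
  have "(f ^^ n) x = (g ^^ n) x \<and> (f ^^ n) x \<in> P" for n
    using assms(3-5) by (induction n) auto
  moreover have "(inv f ^^ n) x = (inv g ^^ n) x \<and> (inv f ^^ n) x \<in> P" for n
    using assms(5) closed inv_eq by (induction n) auto
  ultimately have "int_iter f k x = int_iter g k x" for k
    by (simp add: int_iter_def)
  then show ?thesis by (simp add: cycle_of_def)
qed

lemma cycle_of_refl: "x \<in> cycle_of f x"
  unfolding cycle_of_def int_iter_def by (auto intro: exI[of _ 0])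

lemma cycle_of_step: "f x \<in> cycle_of f x"
  unfolding cycle_of_def int_iter_def by (auto intro!: exI[of _ 1])

lemma int_iter_Suc:
  assumes "bij f"
  shows "int_iter f (k + 1) x = int_iter f k (f x)"
proof (cases "k \<ge> 0")
  case True
  then show ?thesis
    by (simp add: int_iter_def nat_add_distrib funpow_swap1)
next
  case False
  then obtain n where n: "k = - int (Suc n)"
    by (metis int_cases of_nat_0_le_iff)
  \<comment> \<open>For \<open>n = 0\<close> the exponent falls into the nonnegative branch of
    \<open>int_iter\<close>, hence the case split.\<close>
  have "int_iter f (- int n) x = (inv f ^^ n) x"
    by (cases n) (auto simp: int_iter_def nat_add_distrib)
  moreover have "k + 1 = - int n"
    using n by simp
  moreover have "int_iter f k (f x) = (inv f ^^ n) (inv f (f x))"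
    unfolding n int_iter_def by (simp add: funpow_swap1 del: of_nat_Suc)
  ultimately show ?thesis
    using assms by (simp add: bij_is_inj)
qed

text \<open>Shifting all exponents by one permutes the integers. Thus points linked by a chain of
  single steps share a cycle.\<close>

lemma cycle_of_apply:
  assumes "bij f"
  shows "cycle_of f (f x) = cycle_of f x"
proof -
  have "\<exists>j. int_iter f k x = int_iter f j (f x)" for k
    using int_iter_Suc[OF assms, of "k - 1"] by auto
  then show ?thesis
    unfolding cycle_of_def by (auto simp flip: int_iter_Suc[OF assms])
qed

section \<open>Turning a decidable set into a cycle\<close>

lemma nat_step2_induct [case_names 0 1 step]:
  fixes n :: nat
  assumes "P 0" "P 1" "\<And>n. P n \<Longrightarrow> P (n + 2)"
  shows "P n"
  using assms by (induction n rule: induct_nat_012) auto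

text \<open>The successor map of the integers, with \<open>2 * k\<close> coding \<open>k\<close> and
  \<open>2 * k + 1\<close> coding \<open>- (k + 1)\<close>.\<close>

definition zigzag :: "nat \<Rightarrow> nat" where
  "zigzag n = (if even n then n + 2 else if n = 1 then 0 else n - 2)"

lemma bij_zigzag: "bij zigzag"
proof (rule o_bij)
  \<comment> \<open>The integer predecessor in the same coding; 0 goes to 1, the code of -1.\<close>
  let ?g = "\<lambda>n::nat. if odd n then n + 2 else if n = 0 then 1 else n - 2"
  show "?g \<circ> zigzag = id"
    by (auto simp: fun_eq_iff zigzag_def elim!: oddE)
  show "zigzag \<circ> ?g = id"
  proof
    fix n :: nat
    have "n - 2 \<noteq> 1" if "even n"
      using that by presburger
    then show "(zigzag \<circ> ?g) n = id n"
      by (auto simp: zigzag_def)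
  qed
qed

lemma recursive_zigzag: "recursive 1 (\<lambda>xs. zigzag (xs ! 0))"
proof -
  define parity :: "nat \<Rightarrow> nat" where "parity n = n mod 2" for n
  \<comment> \<open>Each step flips 0 and 1, which computes the parity.\<close>
  have "recursive 1 (\<lambda>xs. rec_nat 0 (\<lambda>k r. 1 - (k # r # xs) ! 1) (xs ! 0))"
    by (intro recursive_rec_nat recursive_diff recursive_const recursive.proj) auto
  moreover have "rec_nat 0 (\<lambda>k r. 1 - (k # r # xs) ! 1) n = parity n" for n and xs :: "nat list"
    by (induction n) (auto simp: parity_def mod_Suc)
  ultimately have parity: "recursive 1 (\<lambda>xs. parity (xs ! 0))" by simp
  have "recursive 1 (\<lambda>xs. if parity (xs ! 0) = 0 then xs ! 0 + 2
      else if xs ! 0 = 1 then 0 else xs ! 0 - 2)"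
    by (intro recursive_if_zero recursive_if_eq recursive_add recursive_diff
        recursive_const recursive.proj parity) auto
  then show ?thesis
    by (rule recursive.ext) (simp add: zigzag_def parity_def even_iff_mod_2_eq_zero)
qed

text \<open>A bijection preserving \<open>P\<close> also preserves its complement, so the two pieces
  glue.\<close>

lemma bij_if_bij_betw:
  assumes "bij_betw h P P" "bij f" "f ` P = P"
  shows "bij (\<lambda>x. if x \<in> P then h x else f x)"
proof -
  have "f ` (- P) = - P"
    using assms(2,3) by (simp add: bij_image_Compl_eq)
  then have "bij_betw f (- P) (- P)"
    using assms(2) by (metis bij_betw_subset subset_UNIV)
  from bij_betw_disjoint_Un[OF assms(1) this]
  show ?thesis by (simp add: Compl_eq_Diff_UNIV)
qed

text \<open>Conjugation of \<open>s\<close> by \<open>e\<close>. Only the values of \<open>r\<close>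
  on \<open>P\<close> matter, so any left inverse of \<open>e\<close> on \<open>I\<close> will
  do.\<close>

lemma bij_betw_conj:
  assumes "bij_betw e I P" "bij_betw s I I" "\<And>i. i \<in> I \<Longrightarrow> r (e i) = i"
  shows "bij_betw (\<lambda>x. e (s (r x))) P P"
proof -
  have "bij_betw r P I"
    using assms(1,3) by (intro bij_betw_byWitness[where f' = e]) (auto simp: bij_betw_def)
  with assms show ?thesis
    using bij_betw_trans[of r P I "e \<circ> s" P] bij_betw_trans[of s I I e P]
    by (simp add: comp_def)
qed

text \<open>Number \<open>P\<close> by \<open>e\<close> and conjugate the rotation of the indices
  modulo \<open>card P\<close>; \<open>g\<close> is recursive as a finite change of
  \<open>f\<close>.\<close>

lemma finite_single_cycle:
  assumes f: "bij f" "f ` P = P" "recursive 1 (\<lambda>xs. f (xs ! 0))" and "finite P"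
  obtains g where "bij g" "recursive 1 (\<lambda>xs. g (xs ! 0))" "g ` P = P"
    "\<And>x. x \<notin> P \<Longrightarrow> g x = f x" "\<And>x y. x \<in> P \<Longrightarrow> y \<in> P \<Longrightarrow> y \<in> cycle_of g x"
proof -
  obtain e where e: "bij_betw e {0..<card P} P"
    using ex_bij_betw_nat_finite[OF assms(4)] by blast
  let ?I = "{0..<card P}"
  define s where "s i = Suc i mod card P" for i
  have "bij_betw s ?I ?I"
  proof -
    have "s ` ?I \<subseteq> ?I" by (auto simp: s_def)
    moreover have "inj_on s ?I"
      by (auto simp: inj_on_def s_def mod_Suc split: if_splits)
    ultimately show ?thesis
      by (simp add: bij_betw_def endo_inj_surj)
  qed
  define h where "h x = e (s (inv_into ?I e x))" for x
  define g where "g x = (if x \<in> P then h x else f x)" for x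
  have "bij_betw h P P"
    unfolding h_def using e \<open>bij_betw s ?I ?I\<close>
    by (rule bij_betw_conj) (use e in \<open>auto simp: bij_betw_def\<close>)
  then have "bij g"
    unfolding g_def using f(1,2) by (rule bij_if_bij_betw)
  have "g ` P = P"
    using \<open>bij_betw h P P\<close> by (simp add: g_def bij_betw_def cong: image_cong_simp)
  have cyc: "i < card P \<Longrightarrow> cycle_of g (e i) = cycle_of g (e 0)" for i
  proof (induction i)
    case (Suc i)
    \<comment> \<open>Here \<open>Suc i < card P\<close>, so the reduction in \<open>s\<close> does
      not wrap around.\<close>
    then have "g (e i) = e (Suc i)"
      using e by (auto simp: g_def h_def s_def bij_betw_def)
    with Suc cycle_of_apply[OF \<open>bij g\<close>, of "e i"] show ?case by simp
  qed simp
  have "cycle_of g x = cycle_of g (e 0)" if x: "x \<in> P" for x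
  proof -
    have "x \<in> e ` ?I"
      using x e by (simp add: bij_betw_def)
    then obtain i where "i < card P" "x = e i" by auto
    from cyc[OF this(1)] this(2) show ?thesis by (simp only:)
  qed
  then have "y \<in> cycle_of g x" if "x \<in> P" "y \<in> P" for x y
    using that cycle_of_refl by metis
  moreover have "recursive 1 (\<lambda>xs. g (xs ! 0))"
    by (rule recursive_finite_change[OF assms(4) f(3)]) (simp add: g_def)
  ultimately show ?thesis
    using that \<open>bij g\<close> \<open>g ` P = P\<close> by (simp add: g_def)
qed

text \<open>Conjugate \<open>zigzag\<close> by the increasing enumeration of \<open>P\<close>.
  Decidability gives both a recursive conjugate and a recursive test for gluing it to
  \<open>f\<close>.\<close>

lemma infinite_single_cycle:
  assumes f: "bij f" "f ` P = P" "recursive 1 (\<lambda>xs. f (xs ! 0))" and "infinite P"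
    and dec: "recursive 1 (\<lambda>xs. if xs ! 0 \<in> P then 1 else 0)"
  obtains g where "bij g" "recursive 1 (\<lambda>xs. g (xs ! 0))" "g ` P = P"
    "\<And>x. x \<notin> P \<Longrightarrow> g x = f x" "\<And>x y. x \<in> P \<Longrightarrow> y \<in> P \<Longrightarrow> y \<in> cycle_of g x"
proof -
  obtain r where r: "recursive 1 (\<lambda>xs. r (xs ! 0))" "\<And>n. r (enumerate P n) = n"
    using recursive_enumerate_inverse[OF assms(4) dec] by blast
  let ?e = "enumerate P"
  have e: "bij_betw ?e UNIV P"
    by (rule bij_enumerate[OF assms(4)])
  define h where "h x = ?e (zigzag (r x))" for x
  define g where "g x = (if x \<in> P then h x else f x)" for x
  have h_rec: "recursive 1 (\<lambda>xs. h (xs ! 0))"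
    unfolding h_def
    by (intro recursive_comp1[OF recursive_enumerate[OF assms(4) dec]]
        recursive_comp1[OF recursive_zigzag] r)
  have "bij_betw h P P"
    unfolding h_def using e bij_zigzag r(2) by (rule bij_betw_conj)
  then have "bij g"
    unfolding g_def using f(1,2) by (rule bij_if_bij_betw)
  have "g ` P = P"
    using \<open>bij_betw h P P\<close> by (simp add: g_def bij_betw_def cong: image_cong_simp)
  have g_e: "g (?e n) = ?e (zigzag n)" for n
    using enumerate_in_set[OF assms(4)] by (simp add: g_def h_def r(2))
  have "cycle_of g (?e n) = cycle_of g (?e 0)" for n
  proof (induction n rule: nat_step2_induct)
    case 1
    show ?case
      using cycle_of_apply[OF \<open>bij g\<close>, of "?e 1"] by (simp add: g_e zigzag_def)
  next
    case (step n)
    show ?case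
    \<comment> \<open>On even indices \<open>g\<close> moves from \<open>n\<close> up to
      \<open>n + 2\<close>, on odd ones from \<open>n + 2\<close> down to \<open>n\<close>; either
      way the two points share a cycle.\<close>
    proof (cases "even n")
      case True
      then show ?thesis
        using step cycle_of_apply[OF \<open>bij g\<close>, of "?e n"] by (simp add: g_e zigzag_def)
    next
      case False
      then show ?thesis
        using step cycle_of_apply[OF \<open>bij g\<close>, of "?e (n + 2)"] by (simp add: g_e zigzag_def)
    qed
  qed simp
  then have "cycle_of g x = cycle_of g (?e 0)" if "x \<in> P" for x
    using enumerate_Ex[OF assms(4) that] by blast
  then have "y \<in> cycle_of g x" if "x \<in> P" "y \<in> P" for x y
    using that cycle_of_refl by metis
  moreover have "recursive 1 (\<lambda>xs. if (if xs ! 0 \<in> P then 1 else 0) = (0::nat)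
      then f (xs ! 0) else h (xs ! 0))"
    by (intro recursive_if_zero dec f h_rec)
  then have "recursive 1 (\<lambda>xs. g (xs ! 0))"
    by (rule recursive.ext) (simp add: g_def)
  ultimately show ?thesis
    using that \<open>bij g\<close> \<open>g ` P = P\<close> by (simp add: g_def)
qed

section \<open>Maximal elements of the inner automorphisms\<close>

text \<open>Moving each point within its class already forces both the automorphism condition and
  invariance of every block; the latter also uses surjectivity.\<close>

lemma Inner_iff:
  assumes "equiv UNIV \<Pi>"
  shows "f \<in> Inner \<Pi> \<longleftrightarrow> f \<in> rec_perms \<and> (\<forall>x. (x, f x) \<in> \<Pi>)"
proof
  assume f: "f \<in> Inner \<Pi>"
  have "(x, f x) \<in> \<Pi>" for x
  proof -
    have "f ` (\<Pi> `` {x}) = \<Pi> `` {x}"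
      using f by (simp add: Inner_def quotientI)
    then show ?thesis
      using equiv_class_self[OF assms, of x] by blast
  qed
  with f show "f \<in> rec_perms \<and> (\<forall>x. (x, f x) \<in> \<Pi>)"
    by (simp add: Inner_def Aut_def)
next
  assume f: "f \<in> rec_perms \<and> (\<forall>x. (x, f x) \<in> \<Pi>)"
  then have step: "(x, f x) \<in> \<Pi>" for x by blast
  have sym: "(y, x) \<in> \<Pi>" if "(x, y) \<in> \<Pi>" for x y
    using that assms by (meson equivE symE)
  have trans: "(x, z) \<in> \<Pi>" if "(x, y) \<in> \<Pi>" "(y, z) \<in> \<Pi>" for x y z
    using that assms by (meson equivE transE)
  have "(x, y) \<in> \<Pi> \<longleftrightarrow> (f x, f y) \<in> \<Pi>" for x y
    by (meson step sym trans)
  moreover have "f ` (\<Pi> `` {x}) = \<Pi> `` {x}" for x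
  proof
    show "f ` (\<Pi> `` {x}) \<subseteq> \<Pi> `` {x}"
      using step trans by blast
    show "\<Pi> `` {x} \<subseteq> f ` (\<Pi> `` {x})"
    proof
      fix z
      assume "z \<in> \<Pi> `` {x}"
      \<comment> \<open>The preimage \<open>w\<close> is equivalent to \<open>f w = z\<close>, hence
        lies in the same block.\<close>
      moreover obtain w where "z = f w"
        using f by (auto simp: rec_perms_def bij_def surj_def)
      ultimately show "z \<in> f ` (\<Pi> `` {x})"
        using step sym trans by blast
    qed
  qed
  ultimately show "f \<in> Inner \<Pi>"
    using f by (auto simp: Inner_def Aut_def quotient_def)
qed

lemma Inner_image_block: "f \<in> Inner \<Pi> \<Longrightarrow> f ` block x \<Pi> = block x \<Pi>"
  by (simp add: Inner_def block_def quotientI)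

lemma Inner_cycle_of_subset:
  assumes "equiv UNIV \<Pi>" "f \<in> Inner \<Pi>"
  shows "cycle_of f x \<subseteq> block x \<Pi>"
proof (rule cycle_of_subset_closed)
  show "x \<in> block x \<Pi>"
    using equiv_class_self[OF assms(1)] by (simp add: block_def)
qed (use assms Inner_image_block in \<open>auto simp: Inner_iff rec_perms_def\<close>)

text \<open>Fixing \<open>a\<close> as a constant in the decision procedure for \<open>\<Pi>\<close>
  suffices, since only one block gets modified.\<close>

lemma recursive_block:
  assumes "decidable_rel \<Pi>"
  shows "recursive 1 (\<lambda>xs. if xs ! 0 \<in> block a \<Pi> then 1 else 0)"
  using recursive_comp2[where f = "\<lambda>x y. if (x, y) \<in> \<Pi> then 1 else 0",
      OF assms[unfolded decidable_rel_def] recursive_const[of 1 a] recursive.proj[of 0 1]]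
  by (simp add: block_def)

lemma Inner_strictly_below:
  assumes equiv: "equiv UNIV \<Pi>" and dec: "decidable_rel \<Pi>"
    and f: "f \<in> Inner \<Pi>" and ne: "cycle_of f a \<noteq> block a \<Pi>"
  obtains g where "g \<in> Inner \<Pi>" "f \<lnsim> g"
proof -
  define P where "P = block a \<Pi>"
  have perm: "bij f" "recursive 1 (\<lambda>xs. f (xs ! 0))"
    using f by (auto simp: Inner_iff[OF equiv] rec_perms_def)
  have fP: "f ` P = P"
    using Inner_image_block[OF f] by (simp add: P_def)
  have "a \<in> P"
    using equiv_class_self[OF equiv] by (simp add: P_def block_def)
  obtain g where g: "bij g" "recursive 1 (\<lambda>xs. g (xs ! 0))" "g ` P = P"
    "\<And>x. x \<notin> P \<Longrightarrow> g x = f x" "\<And>x y. x \<in> P \<Longrightarrow> y \<in> P \<Longrightarrow> y \<in> cycle_of g x"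
  proof (cases "finite P")
    case True
    then show ?thesis
      by (rule finite_single_cycle[OF perm(1) fP perm(2)]) (erule (2) that; simp)
  next
    case False
    have "recursive 1 (\<lambda>xs. if xs ! 0 \<in> P then 1 else 0)"
      unfolding P_def by (rule recursive_block[OF dec])
    then show ?thesis
      by (rule infinite_single_cycle[OF perm(1) fP perm(2) False]) (erule (2) that; simp)
  qed
  have same_block: "(x, y) \<in> \<Pi>" if "x \<in> P" "y \<in> P" for x y
    using that equiv unfolding P_def block_def by (metis ImageE equivE singletonD symE transE)
  have "(x, g x) \<in> \<Pi>" for x
  proof (cases "x \<in> P")
    case True
    then show ?thesis using g(3) same_block by blast
  next
    case False
    then show ?thesis using g(4) f by (simp add: Inner_iff[OF equiv])
  qed
  then have "g \<in> Inner \<Pi>"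
    using g(1,2) by (simp add: Inner_iff[OF equiv] rec_perms_def)
  moreover have "f \<lesssim> g"
    unfolding cycle_le_def
  proof
    fix x
    show "cycle_of f x \<subseteq> cycle_of g x"
    proof (cases "x \<in> P")
      case True
      \<comment> \<open>Inside \<open>P\<close>, cycles of \<open>f\<close> stay in
        \<open>P\<close>, and \<open>P\<close> lies in each cycle of \<open>g\<close> through its
        points.\<close>
      then show ?thesis
        using cycle_of_subset_closed[OF perm(1) fP True] g(5) by blast
    next
      case False
      \<comment> \<open>Off \<open>P\<close>, the maps agree on an invariant set, so their cycles
        coincide.\<close>
      have "f ` (- P) = - P"
        using perm(1) fP by (simp add: bij_image_Compl_eq)
      from cycle_of_cong[OF perm(1) g(1) this] show ?thesis
        using g(4) False by auto
    qed
  qed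
  moreover have "\<not> g \<lesssim> f"
  proof
    assume "g \<lesssim> f"
    \<comment> \<open>Together with the reverse inclusion, valid for all of
      \<open>Inner \<Pi>\<close>, this would make the block of \<open>a\<close> a cycle of
      \<open>f\<close>.\<close>
    then have "P \<subseteq> cycle_of f a"
      using g(5)[OF \<open>a \<in> P\<close>] by (auto simp: cycle_le_def)
    then show False
      using ne Inner_cycle_of_subset[OF equiv f, of a] by (simp add: P_def)
  qed
  ultimately show ?thesis
    using that by (simp add: cycle_less_def)
qed

theorem theorem3p23:
  fixes \<Pi> :: "nat rel"
  assumes "equiv UNIV \<Pi>"
    and "decidable_rel \<Pi>"
  shows "Perm \<Pi> = maximal (Inner \<Pi>)"
proof
  show "Perm \<Pi> \<subseteq> maximal (Inner \<Pi>)"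
  proof
    fix f
    assume f: "f \<in> Perm \<Pi>"
    then have cyc: "cycle_of f x = block x \<Pi>" for x
      by (simp add: Perm_def)
    have "(x, f x) \<in> \<Pi>" for x
      using cycle_of_step[of f x] by (simp add: cyc block_def)
    then have "f \<in> Inner \<Pi>"
      using f by (simp add: Inner_iff[OF assms(1)] Perm_def)
    \<comment> \<open>So \<open>f\<close> is even a greatest element for the preorder: cycles of
      \<open>g\<close> stay in blocks, which are the cycles of \<open>f\<close>.\<close>
    moreover have "g \<lesssim> f" if "g \<in> Inner \<Pi>" for g
      using Inner_cycle_of_subset[OF assms(1) that] by (simp add: cycle_le_def cyc)
    ultimately show "f \<in> maximal (Inner \<Pi>)"
      by (auto simp: maximal_def cycle_less_def)
  qed
  show "maximal (Inner \<Pi>) \<subseteq> Perm \<Pi>"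
  proof
    fix f
    assume f: "f \<in> maximal (Inner \<Pi>)"
    then have "cycle_of f x = block x \<Pi>" for x
      using Inner_strictly_below[OF assms, of f x] by (auto simp: maximal_def)
    then show "f \<in> Perm \<Pi>"
      using f by (simp add: Perm_def maximal_def Inner_def Aut_def)
  qed
qed

end
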